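(* Let $W=(W_j)_{j\ge1}$ and $V=(V_{n,k})_{1\le k\le n}$ be nonnegative weights with $W_1=V_{1,1}=1$. The weights $W$ and $V$ define a partition of Gibbs form if and only if for some $b\ge0$ and $a\le b$ the following two conditions are satisfied: (i) $W_j=(b-a)_{j-1\uparrow b}$ for $j=1,2,\ldots$; (ii) the $V_{n,k}$ satisfy the recursion $V_{n,k}=(bn-ak)\,V_{n+1,k}+V_{n+1,k+1}$ for all $1\le k\le n$.
   Context: Notation: $(x)_{m\uparrow\beta}=\prod_{j=1}^m(x+(j-1)\beta)$, with $(x)_{0\uparrow\beta}=1$. An exchangeable random partition of $\mathbb N$ is a consistent sequence $(\Pi_n)$ of random partitions of $[n]=\{1,\ldots,n\}$ ($\Pi_n$ is obtained from $\Pi_{n+1}$ by discarding $n+1$) with the law of each $\Pi_n$ invariant under permutations of $[n]$. Then $\mathbb P(\Pi_n=\{A_1,\ldots,A_k\})=p(|A_1|,\ldots,|A_k|)$ for a nonnegative function $p$ of compositions, called the exchangeable partition probability function (EPPF). An EPPF $p(\lambda_1,\ldots,\lambda_k)$ is symmetric in its arguments for each $k$, has $p(1)=1$, and satisfies the addition rule $p(\lambda)=\sum_\mu p(\mu)$ for every composition $\lambda$, where the sum is over the compositions $\mu$ obtained from $\lambda$ by either increasing one part by one or appending a part $1$ at the end (one term for each part increased, plus one for appending); a nonnegative function with these properties uniquely determines the law of an exchangeable random partition of $\mathbb N$. The weights $W,V$ define a partition of Gibbs form if $p(\lambda_1,\ldots,\lambda_k)=V_{n,k}\prod_{j=1}^kW_{\lambda_j}$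 (for all $1\le k\le n$ and all compositions $(\lambda_1,\ldots,\lambda_k)$ of $n$) is the EPPF of an exchangeable random partition of $\mathbb N$.
   Formalization: The "only if" half is proved under the extra assumption p(2,1) = V_{3,2}W_2W_1 > 0; without it the claim fails, e.g. for V_{n,n}=1, V_{n,k}=0 (k<n), W=(1,1,1,2,1,...), which give the all-singletons partition. The "if" half is unconditional. *)

theory Defs
  imports "HOL-Probability.Probability" "HOL-Combinatorics.Permutations"
begin

definition step_rising :: "real \<Rightarrow> nat \<Rightarrow> real \<Rightarrow> real" where
  "step_rising x m \<beta> = (\<Prod>j=1..m. x + (real j - 1) * \<beta>)"

text \<open>Partitions of \<open>[n] = {1..n}\<close> are sets of disjoint nonempty blocks.  For \<open>n = 0\<close> there
  is only the empty partition, so including that index in the conditions below costs nothing.\<close>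

definition partitions :: "nat \<Rightarrow> nat set set set" where
  "partitions n = {P. partition_on {1..n} P}"

definition restrict_partition :: "nat \<Rightarrow> nat set set \<Rightarrow> nat set set" where
  "restrict_partition n P = (\<lambda>B. B \<inter> {1..n}) ` P - {{}}"

definition random_partition :: "'w measure \<Rightarrow> (nat \<Rightarrow> 'w \<Rightarrow> nat set set) \<Rightarrow> bool" where
  "random_partition M X \<longleftrightarrow>
     prob_space M \<and>
     (\<forall>n. X n \<in> measurable M (count_space (partitions n))) \<and>
     (\<forall>n. \<forall>\<omega>\<in>space M. X n \<omega> = restrict_partition n (X (Suc n) \<omega>))"

definition exchangeable_random_partition ::
    "'w measure \<Rightarrow> (nat \<Rightarrow> 'w \<Rightarrow> nat set set) \<Rightarrow> bool" where
  "exchangeable_random_partition M X \<longleftrightarrow>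
     random_partition M X \<and>
     (\<forall>n \<sigma>. \<sigma> permutes {1..n} \<longrightarrow>
        distr M (count_space (partitions n)) (\<lambda>\<omega>. (`) \<sigma> ` X n \<omega>) =
        distr M (count_space (partitions n)) (X n))"

text \<open>Compositions are lists of positive integers.  A function \<open>p\<close> is only ever evaluated at the
  lists \<open>map card As\<close>, which are exactly the compositions of \<open>n \<ge> 1\<close>; its values at other lists
  are irrelevant.  The list \<open>As\<close> enumerates the blocks of a partition in an arbitrary order.\<close>

definition is_EPPF ::
    "'w measure \<Rightarrow> (nat \<Rightarrow> 'w \<Rightarrow> nat set set) \<Rightarrow> (nat list \<Rightarrow> real) \<Rightarrow> bool" where
  "is_EPPF M X p \<longleftrightarrow>
     (\<forall>n\<ge>1. \<forall>As. distinct As \<and> partition_on {1..n} (set As) \<longrightarrow>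
        measure M {\<omega> \<in> space M. X n \<omega> = set As} = p (map card As))"

definition gibbs_eppf :: "(nat \<Rightarrow> real) \<Rightarrow> (nat \<Rightarrow> nat \<Rightarrow> real) \<Rightarrow> nat list \<Rightarrow> real" where
  "gibbs_eppf W V ls = V (sum_list ls) (length ls) * (\<Prod>l\<leftarrow>ls. W l)"

text \<open>The underlying space is taken to have the type of sequences of partitions.  This is no loss of
  generality: the law of any random partition \<open>(X n)\<close> lives on that sequence space.\<close>

definition defines_gibbs_partition :: "(nat \<Rightarrow> real) \<Rightarrow> (nat \<Rightarrow> nat \<Rightarrow> real) \<Rightarrow> bool" where
  "defines_gibbs_partition W V \<longleftrightarrow>
     (\<exists>(M :: (nat \<Rightarrow> nat set set) measure) X.
        exchangeable_random_partition M X \<and> is_EPPF M X (gibbs_eppf W V))"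

text \<open>Pitfall: an EPPF need not determine its weights.  It vanishes at \<open>[2, 1]\<close> iff almost surely
  every \<open>X n\<close> is trivial (only singletons, or a single block), and then some weights are
  unconstrained.  For example \<open>V n n = 1\<close>, \<open>V n k = 0\<close> for \<open>k < n\<close> define the all-singletons
  partition for every \<open>W\<close> with \<open>W 1 = 1\<close>.  A necessary condition on the weights therefore has to
  exclude the case \<open>gibbs_eppf W V [2, 1] = 0\<close>.\<close>

end

theory Submission
  imports Defs
begin

text \<open>
  Everything rests on the addition rule. A partition \<open>R\<close> of \<open>[n]\<close> with \<open>k\<close> blocks extends to
  \<open>[n + 1]\<close> by putting \<open>n + 1\<close> into one of its blocks or into a block of its own. For Gibbs
  weights the resulting masses add up to
  \<open>(V (n+1) k * (\<Sum>B\<in>R. W (|B| + 1) / W |B|) + V (n+1) (k+1)) * (\<Prod>B\<in>R. W |B|)\<close>,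
  to be compared with \<open>V n k * (\<Prod>B\<in>R. W |B|)\<close>. So the rule holds as soon as
  \<open>W (j + 1) / W j\<close> is an affine function \<open>b * j - a\<close> of \<open>j\<close>, since then the sum of ratios is
  \<open>b * n - a * k\<close>, whatever the block sizes are. Conversely the sum has to depend on \<open>n\<close> and \<open>k\<close>
  only, and that forces the ratio to be affine.

  Sufficiency: under (i) and (ii) the masses of the partitions of \<open>[n + 1]\<close> that restrict to \<open>R\<close>
  add up to the mass of \<open>R\<close> (\<open>gibbs_mass_consistent\<close>). A consistent family of masses on
  finite sets is the family of marginals of a random sequence (\<open>projective_finite_extension\<close>,
  built as a Markov chain), and exchangeability holds because a mass depends on block sizes only.

  Necessity: taking \<open>k = 2\<close> and blocks of sizes \<open>i\<close> and \<open>j\<close>, the sum of the ratios at \<open>i\<close> and \<open>j\<close>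
  depends on \<open>i + j\<close> only, so consecutive ratios differ by a constant \<open>b\<close>
  (\<open>arithmetic_ratios\<close>); their positivity gives \<open>b \<ge> 0\<close>. This needs all \<open>W j\<close> and all
  \<open>V n 2\<close> with \<open>n \<ge> 3\<close> to be positive, that is, \<open>p(n, 1) > 0\<close> for all \<open>n \<ge> 2\<close>. It is propagated
  from \<open>p(2, 1) > 0\<close> by exchangeability (\<open>singleton_1_positive_step\<close>): if \<open>p(n + 1, 1) = 0\<close>, then
  the events that a given set of \<open>n\<close> elements lies in one block away from \<open>1\<close> are almost disjoint
  when the sets differ in a single element; there are arbitrarily many of them, all of
  probability \<open>p(n, 1)\<close>, so \<open>p(n, 1) = 0\<close>.
\<close>

section \<open>Extending a partition by one element\<close>

text \<open>The choice \<open>C = {}\<close> makes \<open>Suc n\<close> a new singleton block: a partition has no empty block, so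
  removing \<open>{}\<close> changes nothing. The extensions of \<open>R\<close> are thus indexed uniformly by
  \<open>insert {} R\<close>.\<close>
definition add_to_block :: "nat \<Rightarrow> nat set set \<Rightarrow> nat set \<Rightarrow> nat set set" where
  "add_to_block n R C = insert (insert (Suc n) C) (R - {C})"

lemma partitions_finite: "finite (partitions n)"
  unfolding partitions_def by (rule finitely_many_partition_on) simp

lemma partitionsD:
  assumes "R \<in> partitions n"
  shows "finite R" "\<And>B. B \<in> R \<Longrightarrow> finite B" "\<And>B. B \<in> R \<Longrightarrow> B \<noteq> {}"
    "\<And>B. B \<in> R \<Longrightarrow> B \<subseteq> {1..n}" "\<Union>R = {1..n}"
    "\<And>B C x. B \<in> R \<Longrightarrow> C \<in> R \<Longrightarrow> x \<in> B \<Longrightarrow> x \<in> C \<Longrightarrow> B = C"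
proof -
  have P: "partition_on {1..n} R" using assms by (simp add: partitions_def)
  show "finite R" using finite_elements[OF _ P] by simp
  show U: "\<Union>R = {1..n}" using P by (auto simp: partition_on_def)
  then show s: "B \<subseteq> {1..n}" if "B \<in> R" for B using that by auto
  show "finite B" if "B \<in> R" for B using finite_subset[OF s[OF that]] by simp
  show "B \<noteq> {}" if "B \<in> R" for B using P that by (auto simp: partition_on_def)
  show "B = C" if "B \<in> R" "C \<in> R" "x \<in> B" "x \<in> C" for B C x
    using partition_onD2[OF P] that unfolding disjoint_def by blast
qed

lemma Suc_notin_block: "R \<in> partitions n \<Longrightarrow> B \<in> R \<Longrightarrow> Suc n \<notin> B"
  using partitionsD(4)[of R n B] by (meson Suc_n_not_le_n atLeastAtMost_iff subsetD)

lemma restrict_partition_in: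
  assumes "Q \<in> partitions (Suc n)"
  shows "restrict_partition n Q \<in> partitions n"
proof -
  have 1: "partition_on ({1..n} \<inter> {1..Suc n}) ((\<inter>) {1..n} ` Q - {{}})"
    using assms by (intro partition_on_restrict) (simp add: partitions_def)
  have 2: "{1..n} \<inter> {1..Suc n} = {1..n}" by auto
  have 3: "(\<inter>) {1..n} = (\<lambda>B. B \<inter> {1..n})" by (rule ext) (rule Int_commute)
  show ?thesis
    using 1 unfolding 2 3 by (simp add: partitions_def restrict_partition_def)
qed

lemma add_to_block_in:
  assumes R: "R \<in> partitions n" and C: "C \<in> insert {} R"
  shows "add_to_block n R C \<in> partitions (Suc n)"
proof -
  have P: "partition_on {1..n} R" using R by (simp add: partitions_def)
  have "partition_on ({1..Suc n} - insert (Suc n) C) (R - {C})"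
  proof (cases "C = {}")
    case True
    have "{1..Suc n} - {Suc n} = {1..n}" by auto
    moreover have "R - {{}} = R" using partitionsD(3)[OF R] by auto
    ultimately show ?thesis using P True by simp
  next
    case False
    with C have C: "C \<in> R" by simp
    have "{1..Suc n} - insert (Suc n) C = {1..n} - C" by auto
    moreover have "partition_on ({1..n} - C) (R - {C})"
      using partition_on_insert[of C "R - {C}" "{1..n}"] P C partitionsD(6)[OF R]
      by (auto simp: insert_absorb disjnt_iff)
    ultimately show ?thesis by simp
  qed
  moreover have "C \<subseteq> {1..n}" using C partitionsD(4)[OF R] by auto
  ultimately show ?thesis
    using C partitionsD(6)[OF R] Suc_notin_block[OF R]
    unfolding add_to_block_def partitions_def mem_Collect_eq
    by (subst partition_on_insert) (auto simp: disjnt_iff)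
qed

lemma restrict_add_to_block:
  assumes R: "R \<in> partitions n" and C: "C \<in> insert {} R"
  shows "restrict_partition n (add_to_block n R C) = R"
proof -
  have "B \<inter> {1..n} = B" if "B \<in> insert {} R" for B
    using that partitionsD(4)[OF R] by auto
  then show ?thesis
    using C partitionsD(3)[OF R] by (auto simp: restrict_partition_def add_to_block_def image_iff)
qed

lemma inj_add_to_block:
  assumes R: "R \<in> partitions n"
  shows "inj_on (add_to_block n R) (insert {} R)"
proof (rule inj_onI)
  fix C D assume C: "C \<in> insert {} R" and D: "D \<in> insert {} R"
    and eq: "add_to_block n R C = add_to_block n R D"
  have nC: "Suc n \<notin> C" and nD: "Suc n \<notin> D" using C D Suc_notin_block[OF R] by auto
  have "insert (Suc n) C \<in> add_to_block n R D"
    unfolding eq[symmetric] by (simp add: add_to_block_def)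
  then have "insert (Suc n) C = insert (Suc n) D"
    using Suc_notin_block[OF R, of "insert (Suc n) C"] unfolding add_to_block_def by blast
  then show "C = D" using nC nD by (simp add: insert_ident)
qed

text \<open>The terms of the addition rule: the block of \<open>Suc n\<close> in an extension of \<open>R\<close>, with \<open>Suc n\<close>
  taken away, is empty or a block of \<open>R\<close>, and the other blocks are those of \<open>R\<close>.\<close>
lemma refines_to_add_to_block:
  assumes R: "R \<in> partitions n"
  shows "{Q \<in> partitions (Suc n). restrict_partition n Q = R} = add_to_block n R ` insert {} R"
proof
  show "add_to_block n R ` insert {} R \<subseteq> {Q \<in> partitions (Suc n). restrict_partition n Q = R}"
    using add_to_block_in[OF R] restrict_add_to_block[OF R] by auto
  show "{Q \<in> partitions (Suc n). restrict_partition n Q = R} \<subseteq> add_to_block n R ` insert {} R"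
  proof
    fix Q assume "Q \<in> {Q \<in> partitions (Suc n). restrict_partition n Q = R}"
    then have Q: "Q \<in> partitions (Suc n)" and R_eq: "R = restrict_partition n Q" by auto
    have "Suc n \<in> \<Union>Q" using partitionsD(5)[OF Q] by simp
    then obtain B where B: "B \<in> Q" "Suc n \<in> B" by blast
    define C where "C = B \<inter> {1..n}"
    have BC: "B = insert (Suc n) C"
      using partitionsD(4)[OF Q B(1)] B(2) by (auto simp: C_def)
    have other: "D \<inter> {1..n} = D" if "D \<in> Q - {B}" for D
    proof -
      have "Suc n \<notin> D" using that partitionsD(6)[OF Q B(1), of D "Suc n"] B(2) by auto
      moreover have "D \<subseteq> insert (Suc n) {1..n}"
        using that partitionsD(4)[OF Q, of D] by (simp add: atLeastAtMostSuc_conv)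
      ultimately show ?thesis by blast
    qed
    have ne: "{} \<notin> Q" using partitionsD(3)[OF Q] by auto
    have "(\<lambda>B. B \<inter> {1..n}) ` Q = insert C ((\<lambda>B. B \<inter> {1..n}) ` (Q - {B}))"
      using B(1) unfolding C_def by blast
    also have "(\<lambda>B. B \<inter> {1..n}) ` (Q - {B}) = Q - {B}"
      using other by simp
    finally have R': "R = insert C (Q - {B}) - {{}}"
      by (simp add: R_eq restrict_partition_def)
    have CQ: "C \<notin> Q - {B}"
    proof
      assume "C \<in> Q - {B}"
      moreover from this have "C \<noteq> {}" using ne by auto
      then obtain x where "x \<in> C" by blast
      moreover have "C \<subseteq> B" by (auto simp: C_def)
      ultimately show False using partitionsD(6)[OF Q B(1), of C x] by blast
    qed
    have "Q = add_to_block n R C"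
      using CQ ne B(1) unfolding R' add_to_block_def BC[symmetric] by auto
    moreover have "C \<in> insert {} R" using R' by auto
    ultimately show "Q \<in> add_to_block n R ` insert {} R" by blast
  qed
qed

section \<open>Gibbs masses of partitions\<close>

lemma sum_card_partition:
  assumes "R \<in> partitions n"
  shows "(\<Sum>B\<in>R. card B) = n"
proof -
  have "disjoint R" using assms by (simp add: partitions_def partition_on_def)
  then have "(\<Sum>B\<in>R. card B) = card (\<Union>R)"
    using partitionsD(2)[OF assms] by (intro card_Union_disjoint[symmetric])
  then show ?thesis using partitionsD(5)[OF assms] by simp
qed

lemma card_block_pos:
  assumes "R \<in> partitions n" "B \<in> R"
  shows "1 \<le> card B"
  using partitionsD(2,3)[OF assms] by (simp add: Suc_le_eq card_gt_0_iff)

lemma card_partition_bounds: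
  assumes R: "R \<in> partitions n" and n: "1 \<le> n"
  shows "1 \<le> card R" "card R \<le> n"
proof -
  have "R \<noteq> {}" using partitionsD(5)[OF R] n by auto
  then show "1 \<le> card R" using partitionsD(1)[OF R] by (simp add: Suc_le_eq card_gt_0_iff)
  have "card R \<le> (\<Sum>B\<in>R. card B)"
    using sum_mono[of R "\<lambda>_. 1" card] card_block_pos[OF R] by simp
  then show "card R \<le> n" using sum_card_partition[OF R] by simp
qed

text \<open>This is the Gibbs EPPF as a function of the partition itself, so that no enumeration of the
  blocks has to be chosen. The weight \<open>V 0 0\<close> is unconstrained, whence the separate value at
  \<open>n = 0\<close>, where the empty partition is the only one.\<close>
definition gibbs_mass :: "(nat \<Rightarrow> real) \<Rightarrow> (nat \<Rightarrow> nat \<Rightarrow> real) \<Rightarrow> nat \<Rightarrow> nat set set \<Rightarrow> real" where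
  "gibbs_mass W V n R = (if n = 0 then 1 else V n (card R) * (\<Prod>B\<in>R. W (card B)))"

lemma gibbs_mass_blocks:
  assumes "distinct As" "partition_on {1..n} (set As)" "1 \<le> n"
  shows "gibbs_mass W V n (set As) = gibbs_eppf W V (map card As)"
proof -
  have P: "set As \<in> partitions n" using assms by (simp add: partitions_def)
  have "sum_list (map card As) = n"
    using assms sum_card_partition[OF P] by (simp add: sum_list_distinct_conv_sum_set)
  moreover have "(\<Prod>B\<in>set As. W (card B)) = prod_list (map (\<lambda>B. W (card B)) As)"
    using assms(1) by (rule prod.distinct_set_conv_list)
  moreover have "card (set As) = length As" using assms(1) by (rule distinct_card)
  ultimately show ?thesis
    using assms(3) by (simp add: gibbs_mass_def gibbs_eppf_def comp_def)
qed

lemma gibbs_mass_add_singleton: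
  assumes "R \<in> partitions n" "W 1 = 1"
  shows "gibbs_mass W V (Suc n) (add_to_block n R {}) =
    V (Suc n) (Suc (card R)) * (\<Prod>B\<in>R. W (card B))"
proof -
  have "R - {{}} = R" using partitionsD(3)[OF assms(1)] by auto
  then have "add_to_block n R {} = insert {Suc n} R" by (simp add: add_to_block_def)
  moreover have "{Suc n} \<notin> R" using Suc_notin_block[OF assms(1)] by auto
  ultimately show ?thesis
    using partitionsD(1)[OF assms(1)] assms(2) by (simp add: gibbs_mass_def)
qed

lemma gibbs_mass_add_to_block:
  assumes R: "R \<in> partitions n" and C: "C \<in> R"
  shows "gibbs_mass W V (Suc n) (add_to_block n R C) =
    V (Suc n) (card R) * (W (Suc (card C)) * (\<Prod>B\<in>R - {C}. W (card B)))"
proof -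
  have "insert (Suc n) C \<notin> R - {C}" using Suc_notin_block[OF R] by auto
  moreover have "Suc n \<notin> C" using Suc_notin_block[OF R C] .
  moreover have "0 < card R" using C partitionsD(1)[OF R] card_gt_0_iff by blast
  ultimately show ?thesis
    using partitionsD(1,2)[OF R] C by (simp add: gibbs_mass_def add_to_block_def)
qed

text \<open>The right-hand side of the addition rule. Products over \<open>R - {C}\<close> stand in for quotients by
  \<open>W (card C)\<close>, which may vanish: in the boundary case \<open>a = b\<close> all \<open>W j\<close> with \<open>j \<ge> 2\<close> do.\<close>
lemma sum_gibbs_mass_children:
  assumes R: "R \<in> partitions n" and W1: "W 1 = 1"
  shows "(\<Sum>Q | Q \<in> partitions (Suc n) \<and> restrict_partition n Q = R. gibbs_mass W V (Suc n) Q) =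
    V (Suc n) (card R) * (\<Sum>C\<in>R. W (Suc (card C)) * (\<Prod>B\<in>R - {C}. W (card B))) +
    V (Suc n) (Suc (card R)) * (\<Prod>B\<in>R. W (card B))"
proof -
  let ?m = "\<lambda>C. gibbs_mass W V (Suc n) (add_to_block n R C)"
  have "{} \<notin> R" using partitionsD(3)[OF R] by auto
  then have "(\<Sum>C\<in>insert {} R. ?m C) = ?m {} + (\<Sum>C\<in>R. ?m C)"
    using partitionsD(1)[OF R] by simp
  also have "(\<Sum>C\<in>R. ?m C) =
      V (Suc n) (card R) * (\<Sum>C\<in>R. W (Suc (card C)) * (\<Prod>B\<in>R - {C}. W (card B)))"
    unfolding sum_distrib_left by (intro sum.cong refl gibbs_mass_add_to_block[OF R])
  also have "?m {} = V (Suc n) (Suc (card R)) * (\<Prod>B\<in>R. W (card B))"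
    using R W1 by (rule gibbs_mass_add_singleton)
  finally show ?thesis
    unfolding refines_to_add_to_block[OF R] sum.reindex[OF inj_add_to_block[OF R]] comp_def
    by simp
qed

section \<open>Random sequences with given marginals on finite sets\<close>

lemma finite_mass_pmf:
  fixes f :: "'a \<Rightarrow> real"
  assumes "finite A" "\<And>x. x \<in> A \<Longrightarrow> 0 \<le> f x" "sum f A = 1"
  obtains p where "\<And>x. x \<in> A \<Longrightarrow> pmf p x = f x"
proof -
  define g where "g x = (if x \<in> A then f x else 0)" for x
  have "(\<integral>\<^sup>+ x. ennreal (g x) \<partial>count_space UNIV) = (\<Sum>x\<in>A. ennreal (g x))"
    by (rule nn_integral_count_space') (use assms in \<open>auto simp: g_def\<close>)
  also have "\<dots> = ennreal (sum f A)"
    using assms by (subst sum_ennreal) (auto simp: g_def)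
  finally have "pmf (embed_pmf g) x = g x" for x
    using assms by (intro pmf_embed_pmf) (auto simp: g_def)
  then show ?thesis
    by (intro that[of "embed_pmf g"]) (simp add: g_def)
qed

text \<open>The Ionescu-Tulcea theorem for a chain with discrete transition kernels, reduced to the
  probabilities of one and of two consecutive coordinates. These determine all that is needed of
  the law, as long as each state determines its predecessors.\<close>
lemma markov_chain_exists:
  fixes \<mu> :: "'a pmf" and K :: "nat \<Rightarrow> 'a \<Rightarrow> 'a pmf"
  obtains M :: "(nat \<Rightarrow> 'a) measure" where
    "prob_space M"
    "sets M = sets (PiM UNIV (\<lambda>_. count_space UNIV))"
    "\<And>x. measure M {\<omega>. \<omega> 0 = x} = pmf \<mu> x"
    "\<And>n x y. measure M {\<omega>. \<omega> n = x \<and> \<omega> (Suc n) = y} =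
        measure M {\<omega>. \<omega> n = x} * pmf (K n x) y"
proof -
  define P where "P i \<omega> = measure_pmf (case i of 0 \<Rightarrow> \<mu> | Suc n \<Rightarrow> K n (\<omega> n))"
    for i :: nat and \<omega> :: "nat \<Rightarrow> 'a"
  define N where "N = (\<lambda>_::nat. count_space (UNIV :: 'a set))"
  interpret IT: Ionescu_Tulcea P N
  proof (rule Ionescu_Tulcea.intro)
    show "P i \<in> measurable (PiM {0..<i} N) (subprob_algebra (N i))" for i
    proof (cases i)
      case 0
      then show ?thesis
        by (simp add: P_def[abs_def] N_def space_subprob_algebra measure_pmf.subprob_space_axioms)
    next
      case (Suc n)
      have "(\<lambda>\<omega>. \<omega> n) \<in> measurable (PiM {0..<i} N) (count_space UNIV)"
        using measurable_component_singleton[of n "{0..<i}" N] Suc by (simp add: N_def)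
      then have "(\<lambda>\<omega>. measure_pmf (K n (\<omega> n))) \<in>
          measurable (PiM {0..<i} N) (subprob_algebra (count_space UNIV))"
        by (rule measurable_compose) (auto simp: space_subprob_algebra measure_pmf.subprob_space_axioms)
      then show ?thesis
        by (simp add: P_def[abs_def] Suc N_def)
    qed
    show "prob_space (P i x)" for i x
      by (simp add: P_def measure_pmf.prob_space_axioms)
  qed
  let ?L = "IT.PF.lim" and ?u = "\<lambda>_. undefined :: 'a"
  have space_N: "space (PiM J N) = PiE J (\<lambda>_. UNIV)" for J
    by (simp add: space_PiM N_def)
  have comp [measurable]: "i \<in> J \<Longrightarrow> (\<lambda>\<omega>. \<omega> i) \<in> measurable (PiM J N) (count_space UNIV)" for i J
    using measurable_component_singleton[of i J N] by (simp add: N_def)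
  have sets1: "{\<omega> \<in> space (PiM J N). \<omega> i = x} \<in> sets (PiM J N)" if "i \<in> J" for i J x
    using measurable_sets[OF comp[OF that], of "{x}"] by (simp add: vimage_def Int_def conj_commute)
  have sets2: "{\<omega> \<in> space (PiM J N). \<omega> i = x \<and> \<omega> j = y} \<in> sets (PiM J N)"
    if "i \<in> J" "j \<in> J" for i j J x y
    using sets.Int[OF sets1[OF that(1)] sets1[OF that(2)], of x y] by (simp add: Int_def conj_ac)
  \<comment> \<open>Events that depend on finitely many coordinates have the probability given by the kernels.\<close>
  have lim: "emeasure ?L {\<omega>. Q (restrict \<omega> {0..<n})} =
      emeasure (IT.C 0 n ?u) {\<omega>\<in>space (PiM {0..<n} N). Q \<omega>}"
    if "{\<omega>\<in>space (PiM {0..<n} N). Q \<omega>} \<in> sets (PiM {0..<n} N)" for Q n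
  proof -
    let ?A = "{\<omega>\<in>space (PiM {0..<n} N). Q \<omega>}"
    have e: "IT.PF.emb UNIV {0..<n} ?A = {\<omega>. Q (restrict \<omega> {0..<n})}"
      by (auto simp: prod_emb_def space_N) (simp_all add: space_PiM N_def)
    have "emeasure ?L (IT.PF.emb UNIV {0..<n} ?A) = emeasure (IT.CI {0..<n}) ?A"
      by (rule IT.lim) (use that in auto)
    also have "\<dots> = emeasure (IT.C 0 n ?u) (IT.PF.emb {0..<n} {0..<n} ?A)"
      by (rule IT.emeasure_CI) (use that in auto)
    also have "IT.PF.emb {0..<n} {0..<n} ?A = ?A"
      by (rule prod_emb_id) (auto simp: space_PiM)
    finally show ?thesis by (simp add: e)
  qed
  have lim1: "emeasure ?L {\<omega>. \<omega> n = x} =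
      emeasure (IT.C 0 (Suc n) ?u) {\<omega>\<in>space (PiM {0..<Suc n} N). \<omega> n = x}"
    for n x
    using lim[of "Suc n" "\<lambda>\<omega>. \<omega> n = x"] sets1[of n "{0..<Suc n}" x] by simp
  have lim2: "emeasure ?L {\<omega>. \<omega> n = x \<and> \<omega> (Suc n) = y} =
      emeasure (IT.C 0 (Suc (Suc n)) ?u) {\<omega>\<in>space (PiM {0..<Suc (Suc n)} N). \<omega> n = x \<and> \<omega> (Suc n) = y}"
    for n x y
    using lim[of "Suc (Suc n)" "\<lambda>\<omega>. \<omega> n = x \<and> \<omega> (Suc n) = y"]
      sets2[of n "{0..<Suc (Suc n)}" "Suc n" x y] by simp
  have u: "?u \<in> space (PiM {0..<0} N)" by (simp add: space_N)
  \<comment> \<open>Integrating out the last coordinate.\<close>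
  have step: "emeasure (IT.C 0 (Suc n) ?u) A =
      (\<integral>\<^sup>+\<omega>. emeasure (P n \<omega>) ((\<lambda>x. fun_upd \<omega> n x) -` A) \<partial>IT.C 0 n ?u)"
    if A: "A \<in> sets (PiM {0..<Suc n} N)" for n A
  proof -
    have "emeasure (IT.C 0 (Suc n) ?u) A = (\<integral>\<^sup>+\<omega>. emeasure (IT.eP n \<omega>) A \<partial>IT.C 0 n ?u)"
      using IT.space_C[OF u, of n] IT.sets_C[OF u, of n] A
      by (simp, intro emeasure_bind[where N="PiM {0..<Suc n} N"])
         (auto cong: measurable_cong_sets simp: space_N)
    also have "\<dots> = (\<integral>\<^sup>+\<omega>. emeasure (P n \<omega>) ((\<lambda>x. fun_upd \<omega> n x) -` A) \<partial>IT.C 0 n ?u)"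
      by (intro nn_integral_cong, subst IT.emeasure_eP)
         (use A IT.space_C[OF u, of n] in \<open>auto simp: N_def\<close>)
    finally show ?thesis .
  qed
  have L: "prob_space ?L"
  proof (rule prob_spaceI)
    have "emeasure ?L UNIV = emeasure (IT.C 0 0 ?u) (space (PiM {0..<0} N))"
      using lim[of 0 "\<lambda>_. True"] by simp
    then show "emeasure ?L (space ?L) = 1"
      using prob_space.emeasure_space_1[OF IT.prob_space_C[OF u, of 0]]
        IT.space_C[OF u, of 0] IT.PF.space_lim
      by (simp only: space_N) (simp add: PiE_UNIV_domain)
  qed
  show ?thesis
  proof (rule that[of ?L])
    show "prob_space ?L" by (rule L)
    show "sets ?L = sets (PiM UNIV (\<lambda>_. count_space UNIV))"
      using IT.PF.sets_lim by (simp add: N_def)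
    interpret L: prob_space ?L by (rule L)
    fix x
    have "emeasure ?L {\<omega>. \<omega> 0 = x} = (\<integral>\<^sup>+\<omega>. ennreal (pmf \<mu> x) \<partial>IT.C 0 0 ?u)"
      unfolding lim1
    proof (subst step, rule sets1)
      show "(\<integral>\<^sup>+\<omega>. emeasure (P 0 \<omega>) ((\<lambda>y. fun_upd \<omega> 0 y) -` {\<omega> \<in> space (PiM {0..<Suc 0} N). \<omega> 0 = x}) \<partial>IT.C 0 0 ?u) =
          (\<integral>\<^sup>+\<omega>. ennreal (pmf \<mu> x) \<partial>IT.C 0 0 ?u)"
      proof (rule nn_integral_cong)
        fix \<omega> assume "\<omega> \<in> space (IT.C 0 0 ?u)"
        then have "(\<lambda>y. fun_upd \<omega> 0 y) -` {\<omega> \<in> space (PiM {0..<Suc 0} N). \<omega> 0 = x} = {x}"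
          using IT.space_C[OF u, of 0] by (auto simp: space_N PiE_iff extensional_def)
        then show "emeasure (P 0 \<omega>) ((\<lambda>y. fun_upd \<omega> 0 y) -` {\<omega> \<in> space (PiM {0..<Suc 0} N). \<omega> 0 = x}) =
            ennreal (pmf \<mu> x)"
          by (simp add: P_def emeasure_pmf_single)
      qed
    qed simp
    also have "\<dots> = ennreal (pmf \<mu> x)"
      using prob_space.emeasure_space_1[OF IT.prob_space_C[OF u, of 0]] by (simp del: IT.C.simps)
    finally have "emeasure ?L {\<omega>. \<omega> 0 = x} = ennreal (pmf \<mu> x)" .
    then show "measure ?L {\<omega>. \<omega> 0 = x} = pmf \<mu> x"
      by (simp add: measure_def)
    fix n y
    have "emeasure ?L {\<omega>. \<omega> n = x \<and> \<omega> (Suc n) = y} =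
       (\<integral>\<^sup>+\<omega>. ennreal (pmf (K n x) y) * indicator {\<omega>\<in>space (PiM {0..<Suc n} N). \<omega> n = x} \<omega>
            \<partial>IT.C 0 (Suc n) ?u)"
      unfolding lim2
    proof (subst step)
      let ?A = "{\<omega> \<in> space (PiM {0..<Suc (Suc n)} N). \<omega> n = x \<and> \<omega> (Suc n) = y}"
      show "?A \<in> sets (PiM {0..<Suc (Suc n)} N)" by (rule sets2) auto
      show "(\<integral>\<^sup>+\<omega>. emeasure (P (Suc n) \<omega>) ((\<lambda>z. fun_upd \<omega> (Suc n) z) -` ?A) \<partial>IT.C 0 (Suc n) ?u) =
          (\<integral>\<^sup>+\<omega>. ennreal (pmf (K n x) y) * indicator {\<omega>\<in>space (PiM {0..<Suc n} N). \<omega> n = x} \<omega>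
            \<partial>IT.C 0 (Suc n) ?u)"
      proof (rule nn_integral_cong)
        fix \<omega> assume "\<omega> \<in> space (IT.C 0 (Suc n) ?u)"
        then have \<omega>: "\<omega> \<in> space (PiM {0..<Suc n} N)"
          using IT.space_C[OF u, of "Suc n"] by simp
        then have "(\<lambda>z. fun_upd \<omega> (Suc n) z) -` ?A = (if \<omega> n = x then {y} else {})"
          by (auto simp: space_N PiE_iff extensional_def)
        then show "emeasure (P (Suc n) \<omega>) ((\<lambda>z. fun_upd \<omega> (Suc n) z) -` ?A) =
            ennreal (pmf (K n x) y) * indicator {\<omega>\<in>space (PiM {0..<Suc n} N). \<omega> n = x} \<omega>"
          using \<omega> by (simp add: P_def emeasure_pmf_single)
      qed
    qed
    also have "\<dots> = ennreal (pmf (K n x) y) * emeasure ?L {\<omega>. \<omega> n = x}"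
      unfolding lim1
      by (rule nn_integral_cmult_indicator) (use sets1[of n "{0..<Suc n}" x] IT.sets_C[OF u, of "Suc n"]
          in \<open>simp del: IT.C.simps\<close>)
    finally show "measure ?L {\<omega>. \<omega> n = x \<and> \<omega> (Suc n) = y} =
        measure ?L {\<omega>. \<omega> n = x} * pmf (K n x) y"
      by (simp add: measure_def enn2real_mult)
  qed
qed

text \<open>Kolmogorov extension for a sequence of finite sets: a Markov chain moves from \<open>x\<close> to a point
  \<open>y\<close> above \<open>x\<close> with probability \<open>m (Suc n) y / m n x\<close>. It stays consistent with the
  projections only almost surely, so the sample space is cut down to the consistent sequences.\<close>
lemma projective_finite_extension:
  fixes S :: "nat \<Rightarrow> 'a set" and \<pi> :: "nat \<Rightarrow> 'a \<Rightarrow> 'a" and m :: "nat \<Rightarrow> 'a \<Rightarrow> real"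
  assumes fin: "\<And>n. finite (S n)"
    and proj: "\<And>n y. y \<in> S (Suc n) \<Longrightarrow> \<pi> n y \<in> S n"
    and nonneg: "\<And>n x. x \<in> S n \<Longrightarrow> 0 \<le> m n x"
    and init: "sum (m 0) (S 0) = 1"
    and add: "\<And>n x. x \<in> S n \<Longrightarrow> (\<Sum>y | y \<in> S (Suc n) \<and> \<pi> n y = x. m (Suc n) y) = m n x"
  obtains M :: "(nat \<Rightarrow> 'a) measure" where
    "prob_space M"
    "\<And>n. (\<lambda>\<omega>. \<omega> n) \<in> measurable M (count_space (S n))"
    "\<And>n \<omega>. \<omega> \<in> space M \<Longrightarrow> \<omega> n = \<pi> n (\<omega> (Suc n))"
    "\<And>n x. x \<in> S n \<Longrightarrow> measure M {\<omega> \<in> space M. \<omega> n = x} = m n x"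
proof -
  \<comment> \<open>Total mass is preserved from level to level, since every point lies above exactly one point.\<close>
  have total: "sum (m n) (S n) = 1" for n
  proof (induction n)
    case (Suc n)
    have "sum (m (Suc n)) (S (Suc n)) = (\<Sum>x\<in>S n. \<Sum>y | y \<in> S (Suc n) \<and> \<pi> n y = x. m (Suc n) y)"
      using fin proj by (intro sum.group[symmetric]) auto
    with Suc add show ?case by simp
  qed (rule init)
  have "\<exists>p. \<forall>y. y \<in> S (Suc n) \<longrightarrow> \<pi> n y = x \<longrightarrow> m n x * pmf p y = m (Suc n) y"
    if x: "x \<in> S n" for n x
  \<comment> \<open>Above a point of mass zero all masses vanish, so there any transition law works.\<close>
  proof (cases "m n x = 0")
    case True
    have "\<forall>y\<in>{y \<in> S (Suc n). \<pi> n y = x}. m (Suc n) y = 0"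
      by (subst sum_nonneg_eq_0_iff[symmetric]) (use add[OF x] True fin nonneg in auto)
    with True show ?thesis by simp
  next
    case False
    obtain p where "\<And>y. y \<in> {y \<in> S (Suc n). \<pi> n y = x} \<Longrightarrow> pmf p y = m (Suc n) y / m n x"
    proof (rule finite_mass_pmf)
      show "finite {y \<in> S (Suc n). \<pi> n y = x}" using fin by simp
      show "0 \<le> m (Suc n) y / m n x" if "y \<in> {y \<in> S (Suc n). \<pi> n y = x}" for y
        using that nonneg[OF x] nonneg[of y "Suc n"] by simp
      show "(\<Sum>y\<in>{y \<in> S (Suc n). \<pi> n y = x}. m (Suc n) y / m n x) = 1"
        using add[OF x] False by (simp flip: sum_divide_distrib)
    qed blast
    with False show ?thesis by (intro exI[of _ p]) auto
  qed
  note ex_K = this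
  define K where "K n x = (SOME p. \<forall>y. y \<in> S (Suc n) \<longrightarrow> \<pi> n y = x \<longrightarrow>
      m n x * pmf p y = m (Suc n) y)" for n x
  have K: "m n x * pmf (K n x) y = m (Suc n) y"
    if "x \<in> S n" "y \<in> S (Suc n)" "\<pi> n y = x" for n x y
    using someI_ex[OF ex_K[OF that(1)]] that(2,3) unfolding K_def by blast
  obtain \<mu> where \<mu>: "\<And>x. x \<in> S 0 \<Longrightarrow> pmf \<mu> x = m 0 x"
    using finite_mass_pmf[OF fin nonneg init] by blast
  obtain L :: "(nat \<Rightarrow> 'a) measure" where "prob_space L"
    and sets_L: "sets L = sets (PiM UNIV (\<lambda>_. count_space UNIV))"
    and L0: "\<And>x. measure L {\<omega>. \<omega> 0 = x} = pmf \<mu> x"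
    and L_step: "\<And>n x y. measure L {\<omega>. \<omega> n = x \<and> \<omega> (Suc n) = y} =
        measure L {\<omega>. \<omega> n = x} * pmf (K n x) y"
    using markov_chain_exists[of \<mu> K] by blast
  interpret L: prob_space L by fact
  have space_L: "space L = UNIV"
    using sets_eq_imp_space_eq[OF sets_L] by (simp add: space_PiM)
  have coord: "(\<lambda>\<omega>. \<omega> n) \<in> measurable L (count_space UNIV)" for n
    using measurable_component_singleton[of n UNIV "\<lambda>_. count_space UNIV"]
    by (simp add: measurable_cong_sets[OF sets_L refl])
  have E: "{\<omega>. \<omega> n = x} \<in> sets L" for n x
    using measurable_sets[OF coord[of n], of "{x}"] by (simp add: space_L vimage_def)
  define J where "J n y = {\<omega>. \<omega> n = \<pi> n y \<and> \<omega> (Suc n) = y}" for n y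
  have J: "J n y \<in> sets L" for n y
    using sets.Int[OF E E, of n "\<pi> n y" "Suc n" y] by (simp add: J_def Int_def)
  \<comment> \<open>\<open>G n\<close> is the event of a consistent step at time \<open>n\<close>; the events \<open>J n y\<close> are disjoint.\<close>
  define G where "G n = (\<Union>y\<in>S (Suc n). J n y)" for n
  have G: "G n \<in> sets L" for n
    unfolding G_def using fin J by blast
  \<comment> \<open>The marginal at time \<open>n\<close> yields full probability of \<open>G n\<close>, which yields the next marginal.\<close>
  have *: "(\<forall>x\<in>S n. measure L {\<omega>. \<omega> n = x} = m n x) \<and> measure L (G n) = 1" for n
  proof (induction n rule: less_induct)
    case (less n)
    have marg: "measure L {\<omega>. \<omega> n = x} = m n x" if x: "x \<in> S n" for x
    proof (cases n)
      case 0
      then show ?thesis using L0 \<mu> x by simp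
    next
      case (Suc k)
      then have IH: "\<forall>x\<in>S k. measure L {\<omega>. \<omega> k = x} = m k x" "measure L (G k) = 1"
        using less.IH[of k] by auto
      have "AE \<omega> in L. \<omega> \<in> G k" using L.prob_eq_1[OF G] IH(2) by simp
      then have "AE \<omega> in L. \<omega> \<in> {\<omega>. \<omega> n = x} \<longleftrightarrow> \<omega> \<in> J k x"
        by eventually_elim (auto simp: G_def J_def Suc)
      then have "measure L {\<omega>. \<omega> n = x} = measure L (J k x)"
        using E J by (intro L.finite_measure_eq_AE)
      also have "\<dots> = measure L {\<omega>. \<omega> k = \<pi> k x} * pmf (K k (\<pi> k x)) x"
        unfolding J_def by (rule L_step)
      also have "measure L {\<omega>. \<omega> k = \<pi> k x} = m k (\<pi> k x)"
        using IH(1) proj[of x k] x Suc by blast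
      also have "m k (\<pi> k x) * pmf (K k (\<pi> k x)) x = m n x"
        unfolding Suc using K[OF proj _ refl, of x k] x Suc by blast
      finally show ?thesis .
    qed
    have "measure L (G n) = (\<Sum>y\<in>S (Suc n). measure L (J n y))"
      unfolding G_def using fin J
      by (intro L.finite_measure_finite_Union) (auto simp: disjoint_family_on_def J_def)
    also have "\<dots> = (\<Sum>y\<in>S (Suc n). m (Suc n) y)"
    proof (rule sum.cong[OF refl])
      fix y assume y: "y \<in> S (Suc n)"
      have "measure L (J n y) = measure L {\<omega>. \<omega> n = \<pi> n y} * pmf (K n (\<pi> n y)) y"
        unfolding J_def by (rule L_step)
      then show "measure L (J n y) = m (Suc n) y"
        unfolding marg[OF proj[OF y]] K[OF proj[OF y] y refl] .
    qed
    finally show ?case using total marg by simp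
  qed
  define \<Omega> where "\<Omega> = (\<Inter>n. G n)"
  have \<Omega>: "\<Omega> \<in> sets L" unfolding \<Omega>_def using G by blast
  have "AE \<omega> in L. \<omega> \<in> G n" for n using L.prob_eq_1[OF G] * by simp
  then have AE: "AE \<omega> in L. \<omega> \<in> \<Omega>" by (simp add: \<Omega>_def AE_all_countable)
  show ?thesis
  proof (rule that[of "restrict_space L \<Omega>"])
    have sp: "space (restrict_space L \<Omega>) = \<Omega>" by (simp add: space_restrict_space space_L)
    show "prob_space (restrict_space L \<Omega>)"
      using L.prob_eq_1[OF \<Omega>] AE \<Omega>
      by (intro prob_space_restrict_space) (simp_all add: L.emeasure_eq_measure)
    have good: "\<omega> n \<in> S n" "\<omega> n = \<pi> n (\<omega> (Suc n))" if "\<omega> \<in> \<Omega>" for \<omega> n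
    proof -
      have "\<omega> \<in> G n" using that by (simp add: \<Omega>_def)
      then obtain y where "y \<in> S (Suc n)" "\<omega> n = \<pi> n y" "\<omega> (Suc n) = y"
        unfolding G_def J_def by blast
      then show "\<omega> n \<in> S n" "\<omega> n = \<pi> n (\<omega> (Suc n))" using proj by simp_all
    qed
    show "(\<lambda>\<omega>. \<omega> n) \<in> measurable (restrict_space L \<Omega>) (count_space (S n))" for n
    proof (subst measurable_count_space_eq2[OF fin], intro conjI ballI)
      show "(\<lambda>\<omega>. \<omega> n) \<in> space (restrict_space L \<Omega>) \<rightarrow> S n" using good(1) by (auto simp: sp)
      show "(\<lambda>\<omega>. \<omega> n) -` {a} \<inter> space (restrict_space L \<Omega>) \<in> sets (restrict_space L \<Omega>)" for a
        using measurable_sets[OF measurable_restrict_space1[OF coord[of n]], of "{a}" \<Omega>] by simp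
    qed
    show "\<omega> n = \<pi> n (\<omega> (Suc n))" if "\<omega> \<in> space (restrict_space L \<Omega>)" for n \<omega>
      by (rule good(2)) (use that in \<open>simp only: sp\<close>)
    show "measure (restrict_space L \<Omega>) {\<omega> \<in> space (restrict_space L \<Omega>). \<omega> n = x} = m n x"
      if "x \<in> S n" for n x
    proof -
      have eq: "{\<omega> \<in> \<Omega>. \<omega> n = x} = \<Omega> \<inter> {\<omega>. \<omega> n = x}" by auto
      have "measure (restrict_space L \<Omega>) {\<omega> \<in> \<Omega>. \<omega> n = x} = measure L {\<omega> \<in> \<Omega>. \<omega> n = x}"
        using \<Omega> by (intro measure_restrict_space) (auto simp: space_L)
      also have "\<dots> = measure L {\<omega>. \<omega> n = x}"
      proof (rule L.finite_measure_eq_AE)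
        show "AE \<omega> in L. \<omega> \<in> {\<omega> \<in> \<Omega>. \<omega> n = x} \<longleftrightarrow> \<omega> \<in> {\<omega>. \<omega> n = x}"
          using AE by eventually_elim simp
      qed (use E \<Omega> eq in auto)
      finally show ?thesis using * that by (simp add: sp)
    qed
  qed
qed

section \<open>Sufficiency of the recursion\<close>

lemma partitions_0: "partitions 0 = {{}}"
  by (auto simp: partitions_def partition_on_empty)

text \<open>The recursion for \<open>W\<close> turns each term for a block \<open>C\<close> into \<open>b * card C - a\<close> times the full
  product; block sizes add up to \<open>n\<close>, so these terms contribute \<open>b * n - a * card R\<close>, which is the
  coefficient in the recursion for \<open>V\<close>.\<close>
lemma gibbs_mass_consistent:
  fixes a b :: real
  assumes W1: "W 1 = 1" and V1: "V 1 1 = 1"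
    and W: "\<And>j. 1 \<le> j \<Longrightarrow> W (Suc j) = (b * real j - a) * W j"
    and V: "\<And>n k. 1 \<le> k \<Longrightarrow> k \<le> n \<Longrightarrow>
      V n k = (b * real n - a * real k) * V (n + 1) k + V (n + 1) (k + 1)"
    and R: "R \<in> partitions n"
  shows "(\<Sum>Q | Q \<in> partitions (Suc n) \<and> restrict_partition n Q = R. gibbs_mass W V (Suc n) Q) =
    gibbs_mass W V n R"
proof (cases "n = 0")
  case True
  then have "R = {}" using R by (simp add: partitions_0)
  with True show ?thesis
    using sum_gibbs_mass_children[where W=W and V=V, OF R W1] V1 by (simp add: gibbs_mass_def)
next
  case False
  let ?w = "\<Prod>B\<in>R. W (card B)"
  have "(\<Sum>C\<in>R. W (Suc (card C)) * (\<Prod>B\<in>R - {C}. W (card B))) =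
      (\<Sum>C\<in>R. (b * real (card C) - a) * ?w)"
    using W card_block_pos[OF R] partitionsD(1)[OF R] by (intro sum.cong) (auto simp: prod.remove mult.assoc)
  also have "\<dots> = (b * real n - a * real (card R)) * ?w"
    using sum_card_partition[OF R]
    by (simp add: sum_subtractf flip: sum_distrib_right sum_distrib_left of_nat_sum)
  finally have "(\<Sum>Q | Q \<in> partitions (Suc n) \<and> restrict_partition n Q = R. gibbs_mass W V (Suc n) Q) =
      V (Suc n) (card R) * ((b * real n - a * real (card R)) * ?w) + V (Suc n) (Suc (card R)) * ?w"
    using sum_gibbs_mass_children[where W=W and V=V, OF R W1] by simp
  also have "\<dots> = V n (card R) * ?w"
  proof -
    have v: "V n (card R) =
        (b * real n - a * real (card R)) * V (Suc n) (card R) + V (Suc n) (Suc (card R))"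
      using V[OF card_partition_bounds[OF R]] False by simp
    show ?thesis unfolding v by (simp add: algebra_simps)
  qed
  finally show ?thesis
    using False by (simp add: gibbs_mass_def)
qed

lemma image_partition_in:
  assumes "\<sigma> permutes {1..n}" and R: "R \<in> partitions n"
  shows "(`) \<sigma> ` R \<in> partitions n"
proof -
  have "partition_on (\<sigma> ` {1..n}) ((`) \<sigma> ` R - {{}})"
    using R permutes_inj_on[OF assms(1)] by (intro partition_on_inj_image) (auto simp: partitions_def)
  moreover have "(`) \<sigma> ` R - {{}} = (`) \<sigma> ` R" using partitionsD(3)[OF R] by auto
  ultimately show ?thesis using permutes_image[OF assms(1)] by (simp add: partitions_def)
qed

lemma gibbs_mass_permute:
  assumes "\<sigma> permutes {1..n}"
  shows "gibbs_mass W V n ((`) \<sigma> ` R) = gibbs_mass W V n R"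
proof -
  have inj: "inj \<sigma>" by (rule permutes_inj[OF assms])
  then have "inj ((`) \<sigma>)" by (simp add: inj_on_def inj_image_eq_iff)
  then show ?thesis
    using inj by (simp add: gibbs_mass_def card_image prod.reindex inj_on_subset[of _ UNIV] inj_on_subset[OF inj])
qed

lemma exchangeable_if_permutation_invariant:
  fixes X :: "nat \<Rightarrow> 'w \<Rightarrow> nat set set"
  assumes X: "random_partition M X"
    and inv: "\<And>(n::nat) \<sigma> Q. \<sigma> permutes {1..n} \<Longrightarrow> Q \<in> partitions n \<Longrightarrow>
      measure M {\<omega> \<in> space M. X n \<omega> = (`) \<sigma> ` Q} = measure M {\<omega> \<in> space M. X n \<omega> = Q}"
  shows "exchangeable_random_partition M X"
  unfolding exchangeable_random_partition_def
proof (intro conjI allI impI X)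
  fix n :: nat and \<sigma> assume \<sigma>: "\<sigma> permutes {1..n}"
  let ?C = "count_space (partitions n)"
  interpret prob_space M using X by (simp add: random_partition_def)
  have meas: "X n \<in> measurable M ?C" using X by (simp add: random_partition_def)
  have "(\<lambda>R. (`) \<sigma> ` R) \<in> measurable ?C ?C" using image_partition_in[OF \<sigma>] by simp
  then have meas_\<sigma>: "(\<lambda>\<omega>. (`) \<sigma> ` X n \<omega>) \<in> measurable M ?C" by (rule measurable_compose[OF meas])
  show "distr M ?C (\<lambda>\<omega>. (`) \<sigma> ` X n \<omega>) = distr M ?C (X n)"
  proof (rule measure_eqI_finite)
    fix Q assume Q: "Q \<in> partitions n"
    have inv_\<sigma>: "inv \<sigma> permutes {1..n}" by (rule permutes_inv[OF \<sigma>])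
    have "(`) \<sigma> ` P = Q \<longleftrightarrow> P = (`) (inv \<sigma>) ` Q" for P
      by (auto simp: image_image permutes_inverses[OF \<sigma>])
    then have "emeasure M ((\<lambda>\<omega>. (`) \<sigma> ` X n \<omega>) -` {Q} \<inter> space M) =
        emeasure M (X n -` {Q} \<inter> space M)"
      using inv[OF inv_\<sigma> Q] by (simp add: emeasure_eq_measure vimage_def Int_def conj_commute)
    then show "emeasure (distr M ?C (\<lambda>\<omega>. (`) \<sigma> ` X n \<omega>)) {Q} = emeasure (distr M ?C (X n)) {Q}"
      using Q meas meas_\<sigma> by (simp add: emeasure_distr)
  qed (auto simp: partitions_finite)
qed

lemma gibbs_recursion_defines_partition:
  fixes a b :: real
  assumes W_nonneg: "\<And>j. 1 \<le> j \<Longrightarrow> 0 \<le> W j"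
    and V_nonneg: "\<And>n k. 1 \<le> k \<Longrightarrow> k \<le> n \<Longrightarrow> 0 \<le> V n k"
    and "W 1 = 1" "V 1 1 = 1"
    and "\<And>j. 1 \<le> j \<Longrightarrow> W (Suc j) = (b * real j - a) * W j"
    and "\<And>n k. 1 \<le> k \<Longrightarrow> k \<le> n \<Longrightarrow>
      V n k = (b * real n - a * real k) * V (n + 1) k + V (n + 1) (k + 1)"
  shows "defines_gibbs_partition W V"
proof -
  have nonneg: "0 \<le> gibbs_mass W V n R" if R: "R \<in> partitions n" for n R
  proof (cases "n = 0")
    case False
    then show ?thesis
      using V_nonneg[OF card_partition_bounds[OF R]] W_nonneg card_block_pos[OF R]
      by (simp add: gibbs_mass_def prod_nonneg)
  qed (simp add: gibbs_mass_def)
  have init: "sum (gibbs_mass W V 0) (partitions 0) = 1"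
    by (simp add: partitions_0 gibbs_mass_def)
  obtain M :: "(nat \<Rightarrow> nat set set) measure" where M:
    "prob_space M"
    "\<And>n. (\<lambda>\<omega>. \<omega> n) \<in> measurable M (count_space (partitions n))"
    "\<And>n \<omega>. \<omega> \<in> space M \<Longrightarrow> \<omega> n = restrict_partition n (\<omega> (Suc n))"
    and law: "\<And>n R. R \<in> partitions n \<Longrightarrow> measure M {\<omega> \<in> space M. \<omega> n = R} = gibbs_mass W V n R"
    using projective_finite_extension[of partitions restrict_partition "gibbs_mass W V",
        OF partitions_finite restrict_partition_in nonneg init
          gibbs_mass_consistent[where W=W and V=V, OF assms(3-6)]] by blast
  let ?X = "\<lambda>n \<omega>. \<omega> n"
  have "random_partition M ?X" using M by (simp add: random_partition_def)
  then have "exchangeable_random_partition M ?X"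
    by (rule exchangeable_if_permutation_invariant) (simp add: law image_partition_in gibbs_mass_permute)
  moreover have "is_EPPF M ?X (gibbs_eppf W V)"
    unfolding is_EPPF_def by (auto simp: law partitions_def gibbs_mass_blocks)
  ultimately show ?thesis unfolding defines_gibbs_partition_def by blast
qed

section \<open>Positivity of the weights\<close>

lemma random_partitionD:
  assumes "random_partition M X"
  shows "prob_space M" "X n \<in> measurable M (count_space (partitions n))"
    "\<omega> \<in> space M \<Longrightarrow> X n \<omega> = restrict_partition n (X (Suc n) \<omega>)"
  using assms unfolding random_partition_def by blast+

lemma random_partition_in:
  assumes "random_partition M X" "\<omega> \<in> space M"
  shows "X n \<omega> \<in> partitions n"
  using measurable_space[OF random_partitionD(2)[OF assms(1)] assms(2)] by simp

lemma random_partition_event: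
  assumes "random_partition M X"
  shows "{\<omega> \<in> space M. P (X n \<omega>)} \<in> sets M"
proof -
  have "X n \<in> measurable M (count_space (partitions n))"
    by (rule random_partitionD(2)[OF assms])
  then have "X n -` {Q \<in> partitions n. P Q} \<inter> space M \<in> sets M"
    by (rule measurable_sets) simp
  moreover have "X n -` {Q \<in> partitions n. P Q} \<inter> space M = {\<omega> \<in> space M. P (X n \<omega>)}"
    using random_partition_in[OF assms] by blast
  ultimately show ?thesis by simp
qed

text \<open>On partitions of \<open>[N]\<close>, \<open>N \<ge> n\<close>, this event for \<open>F = {2..n}\<close> says that the restriction to
  \<open>[n]\<close> has the blocks \<open>{1}\<close> and \<open>{2..n}\<close>. It makes sense for every \<open>F\<close>, and permutations that
  fix \<open>1\<close> move such events into each other.\<close>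
definition joined_without_1 :: "nat set \<Rightarrow> nat set set \<Rightarrow> bool" where
  "joined_without_1 F P \<longleftrightarrow> (\<exists>B\<in>P. F \<subseteq> B \<and> 1 \<notin> B)"

lemma joined_without_1_restrict:
  assumes "F \<subseteq> {1..n}" "F \<noteq> {}"
  shows "joined_without_1 F (restrict_partition n P) \<longleftrightarrow> joined_without_1 F P"
proof
  assume "joined_without_1 F (restrict_partition n P)"
  then obtain B where B: "B \<in> P" "F \<subseteq> B \<inter> {1..n}" "1 \<notin> B \<inter> {1..n}"
    unfolding joined_without_1_def restrict_partition_def by blast
  have "1 \<le> n" using assms by (cases n) auto
  with B show "joined_without_1 F P" unfolding joined_without_1_def by auto
next
  assume "joined_without_1 F P"
  then obtain B where B: "B \<in> P" "F \<subseteq> B" "1 \<notin> B" unfolding joined_without_1_def by blast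
  then have "B \<inter> {1..n} \<in> restrict_partition n P" "F \<subseteq> B \<inter> {1..n}"
    using assms unfolding restrict_partition_def by blast+
  with B(3) show "joined_without_1 F (restrict_partition n P)"
    unfolding joined_without_1_def by blast
qed

lemma joined_without_1_consistent:
  assumes X: "random_partition M X" and \<omega>: "\<omega> \<in> space M"
    and F: "F \<subseteq> {1..n}" "F \<noteq> {}" and "n \<le> N"
  shows "joined_without_1 F (X N \<omega>) \<longleftrightarrow> joined_without_1 F (X n \<omega>)"
  using \<open>n \<le> N\<close>
proof (induction rule: dec_induct)
  case (step m)
  have "X m \<omega> = restrict_partition m (X (Suc m) \<omega>)"
    by (rule random_partitionD(3)[OF X \<omega>])
  moreover have "F \<subseteq> {1..m}" using F(1) step.hyps by auto
  ultimately show ?case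
    using joined_without_1_restrict[of F m "X (Suc m) \<omega>"] F(2) step.IH by simp
qed simp

lemma partition_on_pair:
  assumes "A \<noteq> {}" "B \<noteq> {}" "A \<inter> B = {}"
  shows "partition_on (A \<union> B) {A, B}"
  using assms unfolding partition_on_def disjoint_def by blast

lemma singleton_1_partition:
  assumes "2 \<le> n"
  shows "{{1}, {2..n}} \<in> partitions n"
proof -
  have "{1..n} = {1} \<union> {2..n}" using assms by auto
  then show ?thesis
    using partition_on_pair[of "{1}" "{2..n}"] assms by (simp add: partitions_def)
qed

lemma joined_without_1_all_iff:
  assumes P: "P \<in> partitions n" and n: "2 \<le> n"
  shows "joined_without_1 {2..n} P \<longleftrightarrow> P = {{1}, {2..n}}"
proof
  assume "joined_without_1 {2..n} P"
  then obtain B where B: "B \<in> P" "{2..n} \<subseteq> B" "1 \<notin> B" unfolding joined_without_1_def by blast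
  have split: "{1..n} = insert 1 {2..n}" using n by auto
  have B_eq: "B = {2..n}" using B partitionsD(4)[OF P B(1)] unfolding split by blast
  have "1 \<in> \<Union>P" using partitionsD(5)[OF P] n by simp
  then obtain A where A: "A \<in> P" "1 \<in> A" by blast
  have disj: "C = B" if "C \<in> P" "x \<in> C" "x \<in> {2..n}" for C x
    using partitionsD(6)[OF P B(1) that(1), of x] that B_eq by blast
  have A_eq: "A = {1}"
    using disj[OF A(1)] A B(3) partitionsD(4)[OF P A(1)] unfolding split by blast
  have "C = A \<or> C = B" if C: "C \<in> P" for C
  proof -
    obtain x where x: "x \<in> C" using partitionsD(3)[OF P C] by blast
    then have "x = 1 \<or> x \<in> {2..n}" using partitionsD(4)[OF P C] unfolding split by blast
    then show ?thesis using disj[OF C x] partitionsD(6)[OF P C A(1) x] A(2) by blast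
  qed
  then have "P = {A, B}" using A(1) B(1) by blast
  then show "P = {{1}, {2..n}}" by (simp add: A_eq B_eq)
next
  assume "P = {{1}, {2..n}}"
  then show "joined_without_1 {2..n} P" by (simp add: joined_without_1_def)
qed

lemma joined_without_1_permute:
  assumes "inj \<sigma>" "\<sigma> 1 = 1"
  shows "joined_without_1 (\<sigma> ` F) ((`) \<sigma> ` P) \<longleftrightarrow> joined_without_1 F P"
proof -
  have "1 \<in> \<sigma> ` B \<longleftrightarrow> 1 \<in> B" for B
    using inj_image_mem_iff[OF assms(1), of 1 B] assms(2) by simp
  then show ?thesis
    by (simp add: joined_without_1_def inj_image_subset_iff[OF assms(1)])
qed

lemma ex_permutes_image:
  assumes "finite A" "F \<subseteq> A" "G \<subseteq> A" "card F = card G"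
  obtains \<sigma> where "\<sigma> permutes A" "\<sigma> ` F = G"
proof -
  have fin: "finite F" "finite G" using assms finite_subset by blast+
  obtain f where f: "bij_betw f F G"
    using fin assms(4) finite_same_card_bij by blast
  have "card (A - F) = card (A - G)" using assms fin by (simp add: card_Diff_subset)
  then obtain g where g: "bij_betw g (A - F) (A - G)"
    using finite_same_card_bij[of "A - F" "A - G"] assms(1) by blast
  define \<sigma> where "\<sigma> x = (if x \<in> F then f x else if x \<in> A then g x else x)" for x
  have 1: "bij_betw \<sigma> F G"
    using f by (rule bij_betw_cong[THEN iffD1, rotated]) (simp add: \<sigma>_def)
  have 2: "bij_betw \<sigma> (A - F) (A - G)"
    using g by (rule bij_betw_cong[THEN iffD1, rotated]) (simp add: \<sigma>_def)
  have "bij_betw \<sigma> (F \<union> (A - F)) (G \<union> (A - G))"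
    by (rule bij_betw_combine[OF 1 2]) blast
  moreover have "F \<union> (A - F) = A" "G \<union> (A - G) = A" using assms by blast+
  ultimately have "\<sigma> permutes A"
    using assms(2) by (intro bij_imp_permutes) (auto simp: \<sigma>_def)
  then show ?thesis using that 1 by (simp add: bij_betw_def)
qed

text \<open>Some permutation of \<open>{2..N}\<close> carries \<open>F\<close> onto \<open>{2..n}\<close>. By exchangeability the event for \<open>F\<close>
  has the same probability as the one for \<open>{2..n}\<close>, and the latter is decided by \<open>X n\<close>.\<close>
lemma prob_joined_without_1:
  assumes X: "exchangeable_random_partition M X"
    and F: "F \<subseteq> {2..N}" and card_F: "Suc (card F) = n" and n: "2 \<le> n"
  shows "measure M {\<omega> \<in> space M. joined_without_1 F (X N \<omega>)} =
    measure M {\<omega> \<in> space M. X n \<omega> = {{1}, {2..n}}}"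
proof -
  let ?C = "count_space (partitions N)" and ?G = "{2..n}"
  have rp: "random_partition M X" using X unfolding exchangeable_random_partition_def by blast
  have meas: "X N \<in> measurable M ?C" by (rule random_partitionD(2)[OF rp])
  have "card F \<le> card {2..N}" by (rule card_mono[OF _ F]) simp
  then have nN: "n \<le> N" using card_F n by simp
  obtain \<sigma> where \<sigma>: "\<sigma> permutes {2..N}" "\<sigma> ` F = ?G"
    by (rule ex_permutes_image[of "{2..N}" F ?G]) (use F card_F nN in auto)
  have \<sigma>1: "\<sigma> 1 = 1" using permutes_not_in[OF \<sigma>(1), of 1] by simp
  have \<sigma>N: "\<sigma> permutes {1..N}" by (rule permutes_subset[OF \<sigma>(1)]) auto
  have meas_\<sigma>: "(\<lambda>\<omega>. (`) \<sigma> ` X N \<omega>) \<in> measurable M ?C"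
    by (rule measurable_compose[OF meas]) (use image_partition_in[OF \<sigma>N] in simp)
  let ?A = "{P \<in> partitions N. joined_without_1 ?G P}"
  have A: "f -` ?A \<inter> space M = {\<omega> \<in> space M. joined_without_1 ?G (f \<omega>)}"
    if "f \<in> measurable M ?C" for f
    using measurable_space[OF that] by auto
  have "{\<omega> \<in> space M. joined_without_1 F (X N \<omega>)} =
      {\<omega> \<in> space M. joined_without_1 ?G ((`) \<sigma> ` X N \<omega>)}"
    using joined_without_1_permute[OF permutes_inj[OF \<sigma>(1)] \<sigma>1, of F] \<sigma>(2) by simp
  also have "measure M \<dots> = measure (distr M ?C (\<lambda>\<omega>. (`) \<sigma> ` X N \<omega>)) ?A"
    using measure_distr[OF meas_\<sigma>, of ?A] unfolding A[OF meas_\<sigma>] by simp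
  also have "distr M ?C (\<lambda>\<omega>. (`) \<sigma> ` X N \<omega>) = distr M ?C (X N)"
    using X \<sigma>N unfolding exchangeable_random_partition_def by blast
  also have "measure (distr M ?C (X N)) ?A = measure M {\<omega> \<in> space M. joined_without_1 ?G (X N \<omega>)}"
    using measure_distr[OF meas, of ?A] unfolding A[OF meas] by simp
  also have "{\<omega> \<in> space M. joined_without_1 ?G (X N \<omega>)} =
      {\<omega> \<in> space M. X n \<omega> = {{1}, {2..n}}}"
  proof (rule Collect_cong, rule conj_cong[OF refl])
    fix \<omega> assume \<omega>: "\<omega> \<in> space M"
    have "joined_without_1 ?G (X N \<omega>) \<longleftrightarrow> joined_without_1 ?G (X n \<omega>)"
      by (rule joined_without_1_consistent[OF rp \<omega> _ _ nN]) (use n in auto)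
    also have "\<dots> \<longleftrightarrow> X n \<omega> = {{1}, {2..n}}"
      by (rule joined_without_1_all_iff[OF random_partition_in[OF rp \<omega>] n])
    finally show "joined_without_1 ?G (X N \<omega>) \<longleftrightarrow> X n \<omega> = {{1}, {2..n}}" .
  qed
  finally show ?thesis .
qed

lemma (in prob_space) almost_disjoint_events_bound:
  fixes E :: "nat \<Rightarrow> 'a set"
  assumes E: "\<And>i. E i \<in> events" and c: "\<And>i. i < m \<Longrightarrow> prob (E i) = c"
    and null: "\<And>i j. i < m \<Longrightarrow> j < m \<Longrightarrow> i \<noteq> j \<Longrightarrow> prob (E i \<inter> E j) = 0"
  shows "real m * c \<le> 1"
proof -
  have "AE x in M. x \<notin> E i \<or> x \<notin> E j" if "i < m" "j < m" "i \<noteq> j" for i j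
  proof -
    have "E i \<inter> E j \<in> null_sets M"
      using null[OF that] E by (simp add: null_sets_def emeasure_eq_measure)
    from AE_not_in[OF this] show ?thesis by eventually_elim blast
  qed
  then have "prob (\<Union>i<m. E i) = (\<Sum>i<m. prob (E i))"
    using E by (intro measure_UNION_AE) (auto simp: pairwise_def fmeasurable_eq_sets)
  then show ?thesis using c prob_le_1[of "\<Union>i<m. E i"] by simp
qed

text \<open>The pigeonhole argument. The sets \<open>F i\<close>, for \<open>i < m\<close>, share the elements \<open>2, \<dots>, n - 1\<close> and
  have one further element \<open>n + i\<close> each. If two of the events \<open>E i\<close> occur together, then the two
  blocks coincide because both contain \<open>2\<close>, so \<open>n\<close> elements lie in one block away from \<open>1\<close>; under
  the assumption to be refuted this has probability zero. Then \<open>m * ?q \<le> 1\<close> for all \<open>m\<close>.\<close>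
lemma singleton_1_positive_step:
  assumes X: "exchangeable_random_partition M X" and n: "3 \<le> n"
    and pos: "0 < measure M {\<omega> \<in> space M. X n \<omega> = {{1}, {2..n}}}" (is "0 < ?q")
  shows "0 < measure M {\<omega> \<in> space M. X (Suc n) \<omega> = {{1}, {2..Suc n}}}" (is "0 < ?q'")
proof (rule ccontr)
  assume "\<not> 0 < ?q'"
  then have q': "?q' = 0" by (simp add: not_less measure_le_0_iff)
  have rp: "random_partition M X" using X unfolding exchangeable_random_partition_def by blast
  interpret prob_space M by (rule random_partitionD(1)[OF rp])
  obtain m :: nat where m: "1 < real m * ?q"
    using reals_Archimedean3[OF pos] by blast
  define N where "N = n + m"
  define F where "F i = insert (n + i) {2..<n}" for i
  define E where "E i = {\<omega> \<in> space M. joined_without_1 (F i) (X N \<omega>)}" for i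
  have "real m * ?q \<le> 1"
  proof (rule almost_disjoint_events_bound)
    show "E i \<in> events" for i unfolding E_def by (rule random_partition_event[OF rp])
    show "prob (E i) = ?q" if "i < m" for i
      unfolding E_def by (rule prob_joined_without_1[OF X]) (use that n in \<open>auto simp: F_def N_def\<close>)
    show "prob (E i \<inter> E j) = 0" if ij: "i < m" "j < m" "i \<noteq> j" for i j
    proof -
      let ?J = "{\<omega> \<in> space M. joined_without_1 (insert (n + i) (F j)) (X N \<omega>)}"
      have "E i \<inter> E j \<subseteq> ?J"
      proof
        fix \<omega> assume "\<omega> \<in> E i \<inter> E j"
        then obtain B C where \<omega>: "\<omega> \<in> space M" and B: "B \<in> X N \<omega>" "F i \<subseteq> B" "1 \<notin> B"
          and C: "C \<in> X N \<omega>" "F j \<subseteq> C"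
          unfolding E_def joined_without_1_def by blast
        have "2 \<in> F i" "2 \<in> F j" using n by (auto simp: F_def)
        then have "B = C"
          using partitionsD(6)[OF random_partition_in[OF rp \<omega>] B(1) C(1), of 2] B(2) C(2) by blast
        then show "\<omega> \<in> ?J"
          using \<omega> B C unfolding joined_without_1_def F_def by blast
      qed
      moreover have "prob ?J = ?q'"
        by (rule prob_joined_without_1[OF X]) (use ij n in \<open>auto simp: F_def N_def\<close>)
      ultimately show ?thesis
        using finite_measure_mono[OF _ random_partition_event[OF rp]] q'
        by (metis measure_le_0_iff)
    qed
  qed
  with m show False by simp
qed

section \<open>Necessity of the recursion\<close>

lemma eppf_gibbs_mass:
  assumes "is_EPPF M X (gibbs_eppf W V)" "Q \<in> partitions n" "1 \<le> n"
  shows "measure M {\<omega> \<in> space M. X n \<omega> = Q} = gibbs_mass W V n Q"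
proof -
  obtain As where "distinct As" "set As = Q"
    using finite_distinct_list[OF partitionsD(1)[OF assms(2)]] by blast
  then show ?thesis
    using assms gibbs_mass_blocks[of As n W V] by (auto simp: is_EPPF_def partitions_def)
qed

lemma random_partition_addition_rule:
  assumes X: "random_partition M X" and R: "R \<in> partitions n"
  shows "measure M {\<omega> \<in> space M. X n \<omega> = R} =
    (\<Sum>Q | Q \<in> partitions (Suc n) \<and> restrict_partition n Q = R.
      measure M {\<omega> \<in> space M. X (Suc n) \<omega> = Q})"
proof -
  interpret prob_space M by (rule random_partitionD(1)[OF X])
  let ?S = "{Q \<in> partitions (Suc n). restrict_partition n Q = R}"
  have "{\<omega> \<in> space M. X n \<omega> = R} = (\<Union>Q\<in>?S. {\<omega> \<in> space M. X (Suc n) \<omega> = Q})"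
    using random_partition_in[OF X, of _ "Suc n"] random_partitionD(3)[OF X, of _ n] by blast
  also have "prob \<dots> = (\<Sum>Q\<in>?S. prob {\<omega> \<in> space M. X (Suc n) \<omega> = Q})"
    using partitions_finite random_partition_event[OF X]
    by (intro finite_measure_finite_Union) (auto simp: disjoint_family_on_def)
  finally show ?thesis .
qed

text \<open>With all \<open>W j\<close> positive, the addition rule may be divided by the product of the block weights.\<close>
lemma gibbs_partition_recursion:
  assumes X: "random_partition M X" and E: "is_EPPF M X (gibbs_eppf W V)" and W1: "W 1 = 1"
    and W_pos: "\<And>j. 1 \<le> j \<Longrightarrow> 0 < W j"
    and R: "R \<in> partitions n" and n: "1 \<le> n"
  shows "V n (card R) =
    V (Suc n) (card R) * (\<Sum>C\<in>R. W (Suc (card C)) / W (card C)) + V (Suc n) (Suc (card R))"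
proof -
  let ?w = "\<Prod>B\<in>R. W (card B)"
  have card_W: "0 < W (card B)" if "B \<in> R" for B
    using W_pos card_block_pos[OF R that] by blast
  have w: "0 < ?w" using card_W by (simp add: prod_pos)
  have "V n (card R) * ?w = gibbs_mass W V n R" using n by (simp add: gibbs_mass_def)
  also have "\<dots> = measure M {\<omega> \<in> space M. X n \<omega> = R}"
    by (rule eppf_gibbs_mass[OF E R n, symmetric])
  also have "\<dots> = (\<Sum>Q | Q \<in> partitions (Suc n) \<and> restrict_partition n Q = R.
      measure M {\<omega> \<in> space M. X (Suc n) \<omega> = Q})"
    by (rule random_partition_addition_rule[OF X R])
  also have "\<dots> = (\<Sum>Q | Q \<in> partitions (Suc n) \<and> restrict_partition n Q = R. gibbs_mass W V (Suc n) Q)"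
    by (rule sum.cong[OF refl]) (simp add: eppf_gibbs_mass[OF E])
  also have "\<dots> = V (Suc n) (card R) * (\<Sum>C\<in>R. W (Suc (card C)) * (\<Prod>B\<in>R - {C}. W (card B))) +
      V (Suc n) (Suc (card R)) * ?w"
    using R W1 by (rule sum_gibbs_mass_children)
  also have "(\<Sum>C\<in>R. W (Suc (card C)) * (\<Prod>B\<in>R - {C}. W (card B))) =
      (\<Sum>C\<in>R. W (Suc (card C)) / W (card C)) * ?w"
    unfolding sum_distrib_right
  proof (rule sum.cong[OF refl])
    fix C assume C: "C \<in> R"
    have "?w = W (card C) * (\<Prod>B\<in>R - {C}. W (card B))"
      by (rule prod.remove[OF partitionsD(1)[OF R] C])
    then show "W (Suc (card C)) * (\<Prod>B\<in>R - {C}. W (card B)) = W (Suc (card C)) / W (card C) * ?w"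
      using card_W[OF C] by simp
  qed
  finally have "V n (card R) * ?w = (V (Suc n) (card R) *
      (\<Sum>C\<in>R. W (Suc (card C)) / W (card C)) + V (Suc n) (Suc (card R))) * ?w"
    by (simp add: distrib_right mult.assoc)
  with w show ?thesis by simp
qed

text \<open>With \<open>r j = W (Suc j) / W j\<close>, comparing \<open>(Suc j, 1)\<close> with \<open>(j, 2)\<close> shows that
  \<open>r (Suc j) - r j = r 2 - r 1\<close>. This increment \<open>b\<close> cannot be negative, since \<open>r\<close> stays
  positive, and \<open>a = b - r 1 \<le> b\<close>.\<close>
lemma arithmetic_ratios:
  fixes W :: "nat \<Rightarrow> real"
  assumes W_pos: "\<And>j. 1 \<le> j \<Longrightarrow> 0 < W j"
    and bal: "\<And>i j i' j'. 1 \<le> i \<Longrightarrow> 1 \<le> j \<Longrightarrow> 1 \<le> i' \<Longrightarrow> 1 \<le> j' \<Longrightarrow> i + j = i' + j' \<Longrightarrow>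
      W (Suc i) / W i + W (Suc j) / W j = W (Suc i') / W i' + W (Suc j') / W j'"
  shows "\<exists>b a. 0 \<le> b \<and> a \<le> b \<and> (\<forall>j\<ge>1. W (Suc j) / W j = b * real j - a)"
proof -
  define r where "r j = W (Suc j) / W j" for j
  define b where "b = r 2 - r 1"
  have r_pos: "0 < r j" if "1 \<le> j" for j using W_pos[of j] W_pos[of "Suc j"] that by (simp add: r_def)
  have r_eq: "r j = r 1 + b * (real j - 1)" if "1 \<le> j" for j
    using that
  proof (induction rule: dec_induct)
    case (step j)
    have "r (Suc j) + r 1 = r j + r 2"
      using bal[of "Suc j" 1 j 2] step.hyps by (simp add: r_def)
    then have "r (Suc j) = r j + b" by (simp add: b_def)
    with step.IH show ?case by (simp add: algebra_simps)
  qed simp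
  have "0 \<le> b"
  proof (rule ccontr)
    assume "\<not> 0 \<le> b"
    then obtain k :: nat where k: "r 1 < real k * (- b)"
      using reals_Archimedean3[of "- b"] by (meson neg_0_less_iff_less not_le)
    have "0 < r (Suc k)" by (rule r_pos) simp
    with k show False using r_eq[of "Suc k"] by (simp add: mult.commute)
  qed
  moreover have "b - r 1 \<le> b" using r_pos[of 1] by simp
  moreover have "W (Suc j) / W j = b * real j - (b - r 1)" if "1 \<le> j" for j
    using r_eq[OF that] by (simp add: r_def algebra_simps)
  ultimately show ?thesis by blast
qed

lemma two_block_partition:
  assumes "1 \<le> i" "1 \<le> j"
  shows "{{1..i}, {Suc i..i + j}} \<in> partitions (i + j)" "{1..i} \<noteq> {Suc i..i + j}"
proof -
  have "{1..i + j} = {1..i} \<union> {Suc i..i + j}" "{1..i} \<inter> {Suc i..i + j} = {}"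
    using assms by auto
  then show "{{1..i}, {Suc i..i + j}} \<in> partitions (i + j)"
    using partition_on_pair[of "{1..i}" "{Suc i..i + j}"] assms unfolding partitions_def by simp
  have "1 \<in> {1..i}" "1 \<notin> {Suc i..i + j}" using assms by simp_all
  then show "{1..i} \<noteq> {Suc i..i + j}" by blast
qed

lemma ex_partition_card:
  assumes "1 \<le> k" "k \<le> n"
  obtains R where "R \<in> partitions n" "card R = k"
proof -
  let ?S = "(\<lambda>i. {i}) ` {1..<k}"
  have "{k..n} \<notin> ?S" using assms by force
  moreover have "card ?S = k - 1" by (subst card_image) auto
  ultimately have "card (insert {k..n} ?S) = k" using assms by simp
  moreover have "insert {k..n} ?S \<in> partitions n"
  proof -
    have "{1..n} - {k..n} = {1..<k}" using assms by auto
    moreover have "disjnt {k..n} (\<Union>?S)" by (auto simp: disjnt_iff)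
    ultimately have "partition_on {1..n} (insert {k..n} ?S)"
      using partition_on_singletons[of "{1..<k}"] assms by (simp add: partition_on_insert)
    then show ?thesis by (simp add: partitions_def)
  qed
  ultimately show ?thesis using that by blast
qed

text \<open>Two-block partitions identify the ratios of the \<open>W j\<close>; then any partition of \<open>[n]\<close> into \<open>k\<close>
  blocks gives the recursion for \<open>V n k\<close>.\<close>
lemma gibbs_partition_weights:
  assumes W_nonneg: "\<And>j. 1 \<le> j \<Longrightarrow> 0 \<le> W j"
    and V_nonneg: "\<And>n k. 1 \<le> k \<Longrightarrow> k \<le> n \<Longrightarrow> 0 \<le> V n k"
    and W1: "W 1 = 1"
    and gibbs: "defines_gibbs_partition W V" and pos: "0 < gibbs_eppf W V [2, 1]"
  shows "\<exists>b a. 0 \<le> b \<and> a \<le> b \<and>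
    (\<forall>j\<ge>1. W (Suc j) = (b * real j - a) * W j) \<and>
    (\<forall>n k. 1 \<le> k \<and> k \<le> n \<longrightarrow>
      V n k = (b * real n - a * real k) * V (n + 1) k + V (n + 1) (k + 1))"
proof -
  obtain M :: "(nat \<Rightarrow> nat set set) measure" and X where
    X: "exchangeable_random_partition M X" and E: "is_EPPF M X (gibbs_eppf W V)"
    using gibbs by (auto simp: defines_gibbs_partition_def)
  have rp: "random_partition M X" using X unfolding exchangeable_random_partition_def by blast
  have q: "measure M {\<omega> \<in> space M. X n \<omega> = {{1}, {2..n}}} = V n 2 * W (n - 1)" if "2 \<le> n" for n
  proof -
    have "1 \<notin> {2..n}" by simp
    then have "{1} \<noteq> {2..n}" by blast
    then have "gibbs_mass W V n {{1}, {2..n}} = V n 2 * W (n - 1)"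
      using that W1 by (simp add: gibbs_mass_def numeral_2_eq_2)
    then show ?thesis using eppf_gibbs_mass[OF E singleton_1_partition[OF that]] that by simp
  qed
  \<comment> \<open>The probability \<open>p(n - 1, 1)\<close>, whose positivity splits into that of its two factors.\<close>
  have VW_pos: "0 < V n 2 * W (n - 1)" if "3 \<le> n" for n
    using that
  proof (induction rule: dec_induct)
    case base
    then show ?case using pos W1 by (simp add: gibbs_eppf_def numeral_3_eq_3 numeral_2_eq_2)
  next
    case (step n)
    then show ?case using singleton_1_positive_step[OF X, of n] q[of n] q[of "Suc n"] by simp
  qed
  have W_pos: "0 < W j" if "1 \<le> j" for j
  proof (cases "j = 1")
    case False
    then show ?thesis using VW_pos[of "Suc j"] that W_nonneg[OF that] by (auto simp: zero_less_mult_iff)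
  qed (use W1 in simp)
  have V_pos: "0 < V n 2" if "3 \<le> n" for n
    using VW_pos[OF that] V_nonneg[of 2 n] that by (auto simp: zero_less_mult_iff)
  have rec: "V n (card R) = V (Suc n) (card R) * (\<Sum>C\<in>R. W (Suc (card C)) / W (card C)) +
      V (Suc n) (Suc (card R))" if "R \<in> partitions n" "1 \<le> n" for R n
    by (rule gibbs_partition_recursion[OF rp E W1 _ that]) (rule W_pos)
  have "\<exists>b a. 0 \<le> b \<and> a \<le> b \<and> (\<forall>j\<ge>1. W (Suc j) / W j = b * real j - a)"
  proof (rule arithmetic_ratios[OF W_pos])
    fix i j i' j' :: nat
    assume ij: "1 \<le> i" "1 \<le> j" "1 \<le> i'" "1 \<le> j'" "i + j = i' + j'"
    have two: "V (i + j) 2 = V (Suc (i + j)) 2 * (W (Suc i) / W i + W (Suc j) / W j) + V (Suc (i + j)) 3"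
      if "1 \<le> i" "1 \<le> j" for i j
      using rec[OF two_block_partition(1)[OF that]] two_block_partition(2)[OF that] that
      by (simp add: numeral_2_eq_2 numeral_3_eq_3)
    show "W (Suc i) / W i + W (Suc j) / W j = W (Suc i') / W i' + W (Suc j') / W j'"
      using two[OF ij(1,2)] two[OF ij(3,4)] V_pos[of "Suc (i + j)"] ij by simp
  qed
  then obtain a b :: real where ab: "0 \<le> b" "a \<le> b"
    and r: "\<And>j. 1 \<le> j \<Longrightarrow> W (Suc j) / W j = b * real j - a"
    by blast
  show ?thesis
  proof (rule exI[of _ b], rule exI[of _ a], intro conjI allI impI ab)
    show "W (Suc j) = (b * real j - a) * W j" if "1 \<le> j" for j
      using r[OF that] W_pos[OF that] by (simp add: field_simps)
    fix n k :: nat assume "1 \<le> k \<and> k \<le> n"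
    then have k: "1 \<le> k" "k \<le> n" by auto
    obtain R where R: "R \<in> partitions n" "card R = k" using ex_partition_card[OF k] by blast
    have "(\<Sum>C\<in>R. W (Suc (card C)) / W (card C)) = (\<Sum>C\<in>R. b * real (card C) - a)"
      using r card_block_pos[OF R(1)] by (intro sum.cong) auto
    also have "\<dots> = b * real (\<Sum>C\<in>R. card C) - a * real (card R)"
      by (simp add: sum_subtractf sum_distrib_left)
    also have "\<dots> = b * real n - a * real k"
      using sum_card_partition[OF R(1)] R(2) by simp
    finally show "V n k = (b * real n - a * real k) * V (n + 1) k + V (n + 1) (k + 1)"
      using rec[OF R(1)] k R(2) by simp
  qed
qed

section \<open>The characterisation\<close>

text \<open>The closed form is the solution of the first-order recursion with initial value \<open>W 1 = 1\<close>; all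
  arguments above use the recursion.\<close>
lemma step_rising_weights_iff:
  fixes a b :: real
  assumes "W 1 = 1"
  shows "(\<forall>j\<ge>1. W j = step_rising (b - a) (j - 1) b) \<longleftrightarrow>
    (\<forall>j\<ge>1. W (Suc j) = (b * real j - a) * W j)"
proof -
  have step: "step_rising (b - a) (Suc m) b = (b * real (Suc m) - a) * step_rising (b - a) m b" for m
    by (simp add: step_rising_def algebra_simps)
  show ?thesis
  proof (intro iffI allI impI)
    fix j :: nat assume "\<forall>j\<ge>1. W j = step_rising (b - a) (j - 1) b" "1 \<le> j"
    then show "W (Suc j) = (b * real j - a) * W j"
      using step[of "j - 1"] by simp
  next
    fix j :: nat assume *: "\<forall>j\<ge>1. W (Suc j) = (b * real j - a) * W j" and "1 \<le> j"
    from \<open>1 \<le> j\<close> show "W j = step_rising (b - a) (j - 1) b"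
    proof (induction rule: dec_induct)
      case base
      then show ?case using assms by (simp add: step_rising_def)
    next
      case (step j)
      then show ?case using * \<open>\<And>m. step_rising (b - a) (Suc m) b = _\<close>[of "j - 1"] by simp
    qed
  qed
qed

theorem lemma2:
  fixes W :: "nat \<Rightarrow> real" and V :: "nat \<Rightarrow> nat \<Rightarrow> real"
  assumes "\<And>j. 1 \<le> j \<Longrightarrow> 0 \<le> W j"
    and "\<And>n k. 1 \<le> k \<Longrightarrow> k \<le> n \<Longrightarrow> 0 \<le> V n k"
    and "W 1 = 1" and "V 1 1 = 1"
  shows "((\<exists>b a. 0 \<le> b \<and> a \<le> b \<and>
             (\<forall>j\<ge>1. W j = step_rising (b - a) (j - 1) b) \<and>
             (\<forall>n k. 1 \<le> k \<and> k \<le> n \<longrightarrow>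
                V n k = (b * real n - a * real k) * V (n + 1) k + V (n + 1) (k + 1)))
          \<longrightarrow> defines_gibbs_partition W V) \<and>
         (defines_gibbs_partition W V \<and> 0 < gibbs_eppf W V [2, 1]
          \<longrightarrow> (\<exists>b a. 0 \<le> b \<and> a \<le> b \<and>
             (\<forall>j\<ge>1. W j = step_rising (b - a) (j - 1) b) \<and>
             (\<forall>n k. 1 \<le> k \<and> k \<le> n \<longrightarrow>
                V n k = (b * real n - a * real k) * V (n + 1) k + V (n + 1) (k + 1))))"
proof (intro conjI impI)
  assume "\<exists>b a. 0 \<le> b \<and> a \<le> b \<and>
     (\<forall>j\<ge>1. W j = step_rising (b - a) (j - 1) b) \<and>
     (\<forall>n k. 1 \<le> k \<and> k \<le> n \<longrightarrow>
        V n k = (b * real n - a * real k) * V (n + 1) k + V (n + 1) (k + 1))"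
  then obtain a b where
    "\<And>j. 1 \<le> j \<Longrightarrow> W (Suc j) = (b * real j - a) * W j"
    "\<And>n k. 1 \<le> k \<Longrightarrow> k \<le> n \<Longrightarrow>
      V n k = (b * real n - a * real k) * V (n + 1) k + V (n + 1) (k + 1)"
    using step_rising_weights_iff[of W, OF assms(3)] by blast
  with assms show "defines_gibbs_partition W V" by (rule gibbs_recursion_defines_partition)
next
  assume "defines_gibbs_partition W V \<and> 0 < gibbs_eppf W V [2, 1]"
  then have gibbs: "defines_gibbs_partition W V" "0 < gibbs_eppf W V [2, 1]" by blast+
  have "\<exists>b a. 0 \<le> b \<and> a \<le> b \<and>
     (\<forall>j\<ge>1. W (Suc j) = (b * real j - a) * W j) \<and>
     (\<forall>n k. 1 \<le> k \<and> k \<le> n \<longrightarrow>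
        V n k = (b * real n - a * real k) * V (n + 1) k + V (n + 1) (k + 1))"
    by (rule gibbs_partition_weights[OF _ _ assms(3) gibbs]) (fact assms)+
  then show "\<exists>b a. 0 \<le> b \<and> a \<le> b \<and>
     (\<forall>j\<ge>1. W j = step_rising (b - a) (j - 1) b) \<and>
     (\<forall>n k. 1 \<le> k \<and> k \<le> n \<longrightarrow>
        V n k = (b * real n - a * real k) * V (n + 1) k + V (n + 1) (k + 1))"
    by (simp only: step_rising_weights_iff[of W, OF assms(3)])
qed

end
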